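(* The positive integers $n$ for which $a(n)=1$, i.e. the numbers $n$ of coins for which the Baron can confirm the weight of some coin in one weighing, are exactly those described by the following five cases (with a weighing that works in each case): (1) $n$ is a triangular number: $n=T_i$. Then the weighing $1+2+3+\cdots+i=n$ proves the weight of the $n$-gram coin. (2) $n=2$. The weighing $1<2$ proves the weight of both coins. (3) $n$ is a triangular number plus one: $n=T_i+1$. Then the weighing $1+2+3+\cdots+i<n$ proves the weight of the $n$-gram coin. (4) $n$ is the index of a triangular number that is a square plus one: $T_n=k^2+1$. Then the weighing $1+2+3+\cdots+(k-1)<(k+1)+\cdots+n$ proves the weight of the $k$-gram coin. (5) $n$ is the index of a square triangular number: $T_n=k^2$. Then the weighing $1+2+3+\cdots+(k-1)=(k+1)+\cdots+n$ proves the weight of the $k$-gram coin. The sequence of indices $n$ with $a(n)=1$ starts as: 1, 2, 3, 4, 6, 7, 8, 10, 11, 15, 16, 21, 22, 25, 28, 29, 36, 37, 45, 46, 49, 55, 56, 66, 67, 78, 79, 91, 92.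
   Context: $T_x=x(x+1)/2$ denotes the $x$-th triangular number. There are $n$ coins weighing $1,2,\ldots,n$ grams (one of each weight). Identify each coin with its true weight, so the coins are the elements of $\{1,\ldots,n\}$. Baron M\"unchhausen knows all the weights; the audience knows only that the weights are $1,\ldots,n$ in some order. A weighing on a balance scale is an ordered pair $(L,R)$ of disjoint nonempty subsets of $\{1,\ldots,n\}$ (the coins in the left and right cups); its outcome is whether $\sum_{x\in L}x$ is less than, equal to, or greater than $\sum_{x\in R}x$. A weighing is written as an equality or inequality whose left and right sides list the coins in the left and right cups (each coin denoted by its weight, with parentheses such as $(k+1)$ denoting a single coin of that weight) and whose relation sign is the outcome. The audience can tell the coins apart and track them across weighings, and sees the outcomes. A sequence of weighings $(L_1,R_1),\ldots,(L_m,R_m)$ proves (confirms) the weight of coin $k$ if every permutation $\sigma$ of $\{1,\ldots,n\}$ that is consistent with all the outcomes (i.e. for each $r$, $\sum_{x\in L_r}\sigma(x)-\sum_{x\in R_r}\sigma(x)$ has the same sign, negative, zero or positive, as $\sum_{x\in L_r}x-\sum_{x\in R_r}x$) satisfies $\sigma(k)=k$. Baron M\"unchhausen's sequence $a(n)$ is the minimum number of weighings the Baron must conduct to prove the weight of at least one of the coins.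
   Formalization: The characterization and weighings are stated for n ≥ 2 and the list omits 1: with one coin no weighing with disjoint nonempty cups exists and the empty sequence already proves the coin, so a(1)=0, not 1. *)

theory Defs
  imports Complex_Main "HOL-Combinatorics.Permutations"
begin

definition triangular :: "nat \<Rightarrow> nat" where
  "triangular x = x * (x + 1) div 2"

definition weighing :: "nat \<Rightarrow> nat set \<times> nat set \<Rightarrow> bool" where
  "weighing n w \<longleftrightarrow>
     fst w \<subseteq> {1..n} \<and> snd w \<subseteq> {1..n} \<and>
     fst w \<inter> snd w = {} \<and> fst w \<noteq> {} \<and> snd w \<noteq> {}"

(* The result of weighing w if coin x weighs s x grams: -1, 0, 1 stand for left cup
   lighter, balance, left cup heavier.  The true outcome is outcome id w. *)
definition outcome :: "(nat \<Rightarrow> nat) \<Rightarrow> nat set \<times> nat set \<Rightarrow> int" where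
  "outcome s w = sgn ((\<Sum>x\<in>fst w. int (s x)) - (\<Sum>x\<in>snd w. int (s x)))"

definition consistent :: "nat \<Rightarrow> (nat set \<times> nat set) list \<Rightarrow> (nat \<Rightarrow> nat) \<Rightarrow> bool" where
  "consistent n ws s \<longleftrightarrow>
     s permutes {1..n} \<and> (\<forall>w\<in>set ws. outcome s w = outcome id w)"

definition proves_weight :: "nat \<Rightarrow> (nat set \<times> nat set) list \<Rightarrow> nat \<Rightarrow> bool" where
  "proves_weight n ws k \<longleftrightarrow>
     (\<forall>w\<in>set ws. weighing n w) \<and> k \<in> {1..n} \<and> (\<forall>s. consistent n ws s \<longrightarrow> s k = k)"

(* Only meaningful for n > 0.  In particular baron_seq 1 = 0: the empty sequence of
   weighings already proves the weight of a single coin. *)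
definition baron_seq :: "nat \<Rightarrow> nat" where
  "baron_seq n = (LEAST m. \<exists>ws k. length ws = m \<and> proves_weight n ws k)"

end

theory Submission
  imports Defs
begin

text \<open>
A permutation consistent with a single weighing \<open>(L, R)\<close> amounts to a choice of disjoint weight
sets \<open>A\<close>, \<open>B\<close> of the sizes of \<open>L\<close> and \<open>R\<close> whose sums compare in the same way. Two coins that lie
in the same cup, or both aside, can be exchanged, so a proved coin \<open>k\<close> is alone in its class
(\<open>proved_coin_alone\<close>), and every consistent choice of \<open>A\<close>, \<open>B\<close> must put the weight \<open>k\<close> itself
into that class (\<open>proves_weight_rearranged\<close>).

If \<open>k\<close> is alone in a cup against \<open>a\<close> coins, the cheapest choice \<open>{1..a}\<close> for the other cup leaves
the weight of \<open>k\<close> free to be any number above \<open>T\<^sub>a\<close> (or \<open>T\<^sub>a\<close> as well as \<open>T\<^sub>a + 1\<close> in case of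
balance) unless \<open>n\<close> is too small; this gives \<open>n = T\<^sub>a + 1\<close> and \<open>n = T\<^sub>a\<close>. A single coin in the lighter
cup can have weight 1 or 2 unless \<open>n = 2\<close>.

If \<open>k\<close> is the only coin aside, write \<open>a\<close> for the number of coins in \<open>L\<close>. When a coin of weight \<open>j\<close>
is aside, \<open>R\<close> outweighs \<open>L\<close> by \<open>T\<^sub>n - j - 2 \<Sum>A\<close>, and adding the bounds \<open>T\<^sub>a \<le> \<Sum>A\<close> and
\<open>T\<^sub>a\<^sub>+\<^sub>1 \<le> \<Sum>A + j\<close> shows that this is at most \<open>T\<^sub>n - (a + 1)\<^sup>2 - \<bar>j - (a + 1)\<bar>\<close>
(\<open>square_le_double_sum\<close>), a bound that is attained. Hence \<open>j = a + 1\<close> is the only possibility if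
the maximal difference \<open>T\<^sub>n - (a + 1)\<^sup>2\<close> is 0 and the cups balance, or if it is 1 and \<open>R\<close> is
heavier. This proves that the weighings of cases (4) and (5) work. Conversely, for a strict outcome a
larger maximal difference allows \<open>j = a + 2\<close> too.

The remaining converse, balanced cups and \<open>T\<^sub>n > (a + 1)\<^sup>2\<close> where \<open>L\<close> is the cup with more coins, is the
hard part. If \<open>R\<close> is a single coin then \<open>n \<le> 4\<close>. Otherwise, depending on the parity of \<open>T\<^sub>n - (a + 1)\<^sup>2\<close>, both weights \<open>j = a + 1 - e\<close> and
\<open>j = a + 1 + e\<close>, with \<open>e = 1\<close> or \<open>e = 2\<close>, can be put aside with balanced cups. That the required
sums occur follows from \<open>subset_sum_with_hole\<close>: the sums of \<open>a\<close>-element subsets of \<open>{1..n} - {j}\<close>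
fill an interval, apart from possible gaps right next to its ends, if \<open>a\<close> and \<open>n - 1 - a\<close> are at
least 2.
\<close>

section \<open>Triangular numbers and subset sums\<close>

lemma double_triangular: "2 * triangular x = x * x + x"
  by (simp add: triangular_def)

lemma triangular_add: "triangular (a + d) = triangular a + triangular d + a * d"
proof -
  have "2 * triangular (a + d) = 2 * (triangular a + triangular d + a * d)"
    unfolding double_triangular distrib_left by (simp add: algebra_simps)
  then show ?thesis by simp
qed

lemma triangular_0 [simp]: "triangular 0 = 0"
  by (simp add: triangular_def)

lemma triangular_Suc: "triangular (Suc n) = triangular n + Suc n"
  using triangular_add[of n 1] by (simp add: triangular_def)

lemma triangular_mono: "a \<le> b \<Longrightarrow> triangular a \<le> triangular b"
  using triangular_add[of a "b - a"] by simp

lemma sum_atLeast1: "\<Sum>{1..n} = triangular n"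
  by (induction n) (simp_all add: triangular_Suc)

lemma triangular_le_sum:
  assumes "finite A" "0 \<notin> A"
  shows "triangular (card A) \<le> \<Sum>A"
  using assms
proof (induction A rule: finite_linorder_max_induct)
  case (insert b A)
  have "A \<subseteq> {1..<b}"
    using insert by (auto simp: Suc_le_eq intro: Nat.gr0I)
  from card_mono[OF _ this] have "Suc (card A) \<le> b"
    using insert.prems by (cases b) auto
  moreover have "b \<notin> A" using insert.hyps by auto
  ultimately show ?case
    using insert by (simp add: triangular_Suc)
qed simp

text \<open>
The set \<open>A\<close> has sum at least \<open>T\<^sub>a\<close>, and \<open>insert j A\<close> has sum at least \<open>T\<^sub>a\<^sub>+\<^sub>1\<close>. Adding both bounds
gives the square \<open>T\<^sub>a + T\<^sub>a\<^sub>+\<^sub>1 = (a + 1)\<^sup>2\<close>; doubling the better one of the two gives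
the extra distance of \<open>j\<close> from \<open>a + 1\<close>.
\<close>
lemma square_le_double_sum:
  assumes "finite A" "0 \<notin> A" "j \<notin> A" "0 < j"
  shows "(card A + 1)^2 + nat \<bar>int j - int (card A + 1)\<bar> \<le> 2 * \<Sum>A + j"
proof -
  have "triangular (card A) \<le> \<Sum>A"
    using assms by (intro triangular_le_sum)
  moreover have "triangular (card A + 1) \<le> \<Sum>A + j"
    using triangular_le_sum[of "insert j A"] assms by simp
  moreover have "(card A + 1)^2 = 2 * triangular (card A) + (card A + 1)"
    "(card A + 1)^2 + (card A + 1) = 2 * triangular (card A + 1)"
    unfolding double_triangular by (simp_all add: power2_eq_square algebra_simps)
  ultimately show ?thesis by linarith
qed

text \<open>
The last hypothesis is the upper bound by the sum of the \<open>a\<close> largest elements, in the form of a lower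
bound for the complementary subset. The induction takes the largest element only when the sum cannot
be reached without it.
\<close>
lemma subset_sum_interval:
  assumes "a \<le> n" "triangular a \<le> s" "s + triangular (n - a) \<le> triangular n"
  shows "\<exists>A\<subseteq>{1..n}. card A = a \<and> \<Sum>A = s"
  using assms
proof (induction n arbitrary: a s)
  case 0
  then show ?case by auto
next
  case (Suc n)
  consider "a = Suc n" | "a \<le> n" "s + triangular (n - a) \<le> triangular n"
    | "a \<le> n" "triangular n < s + triangular (n - a)"
    using Suc.prems(1) by linarith
  then show ?case
  proof cases
    case 1
    then have "s = triangular (Suc n)" using Suc.prems by simp
    then show ?thesis
      using 1 sum_atLeast1[of "Suc n"] by (intro exI[of _ "{1..Suc n}"]) simp
  next
    case 2
    then obtain A where "A \<subseteq> {1..n}" "card A = a" "\<Sum>A = s"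
      using Suc.IH Suc.prems by blast
    then show ?thesis by (intro exI[of _ A]) auto
  next
    case 3
    then obtain d where d: "n = a + d" using le_Suc_ex by blast
    have "a \<noteq> 0" using 3 Suc.prems by (intro notI) simp
    then obtain a' where a': "a = Suc a'" using not0_implies_Suc by blast
    have "triangular a + a * d < s"
      using 3 d triangular_add[of a d] by simp
    moreover have "d \<le> a * d" using a' by simp
    ultimately have low: "triangular a' + Suc n \<le> s"
      using d a' by (simp add: triangular_Suc)
    have "s - Suc n + triangular (n - a') \<le> triangular n"
      using Suc.prems(3) low a' by (simp add: triangular_Suc)
    then obtain A where A: "A \<subseteq> {1..n}" "card A = a'" "\<Sum>A = s - Suc n"
      using Suc.IH[of a' "s - Suc n"] low 3 a' by force
    have "finite A" "Suc n \<notin> A" using A finite_subset by auto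
    then show ?thesis
      using A low a' by (intro exI[of _ "insert (Suc n) A"]) auto
  qed
qed

text \<open>
Consider subsets of \<open>{1..p + 1 + q} - {p + 1}\<close> with \<open>t\<close> elements below the hole and \<open>v\<close> above it,
leaving \<open>x\<close> and \<open>y\<close> elements to the complement. By \<open>subset_sum_interval\<close> on either side of the hole,
their sums fill an interval, and \<open>s\<close> lies in it iff \<open>s\<close> and the complementary sum \<open>c\<close> are at least the
least possible ones; these are the two inequalities obtained here. As \<open>t\<close> decreases the
interval moves up, so the least \<open>t\<close> whose interval does not start above \<open>s\<close> is taken. The
intervals for \<open>t = t' + 1\<close> and for \<open>t'\<close> overlap or touch as soon as \<open>t' * x + v * (y - 1)\<close> is positive;
the hypotheses on \<open>a\<close> and \<open>b\<close> exclude all other cases except \<open>t = 1\<close>, \<open>y = 1\<close>, \<open>b = p\<close>, where the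
gap is the second largest value and is avoided by \<open>triangular b + 2 \<le> c\<close>.
\<close>
lemma split_sizes:
  assumes ab: "a + b = p + q" and "2 \<le> a" "2 \<le> b" "a \<noteq> p"
    and s1: "triangular a \<le> s" and s2: "triangular (a + 1) \<le> s + (p + 1)"
    and c1: "triangular b + 2 \<le> c" and c2: "triangular (b + 1) + 2 \<le> c + (p + 1)"
    and total: "s + c + (p + 1) = triangular (p + 1 + q)"
  obtains t v x y where "t + v = a" "t + x = p" "v + y = q"
    "triangular t + triangular v + v * (p + 1) \<le> s"
    "triangular x + triangular y + y * (p + 1) \<le> c"
proof -
  define P where "P t \<longleftrightarrow> t \<le> a \<and> t \<le> p \<and> a - t \<le> q \<and>
    triangular t + triangular (a - t) + (a - t) * (p + 1) \<le> s" for t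
  have total': "s + c = triangular p + triangular q + q * (p + 1)"
    using total triangular_add[of "p + 1" q] triangular_add[of p 1]
    by (simp add: triangular_Suc algebra_simps)
  \<comment> \<open>Taking as many elements as possible below the hole gives the least sum of all.\<close>
  have "P (min a p)"
  proof (cases "a \<le> p")
    case True
    then show ?thesis using s1 by (simp add: P_def)
  next
    case False
    then obtain d where d: "a = p + d" using le_Suc_ex by (metis nat_le_linear)
    have "triangular p + triangular d + d * (p + 1) \<le> s"
      using s2 triangular_add[of p "d + 1"] triangular_add[of d 1]
      by (simp add: d triangular_Suc algebra_simps)
    then show ?thesis using d assms by (simp add: P_def)
  qed
  define t where "t = (LEAST t. P t)"
  have Pt: "P t" and least: "\<And>u. u < t \<Longrightarrow> \<not> P u"
    unfolding t_def using \<open>P (min a p)\<close> by (auto intro: LeastI dest: not_less_Least)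
  obtain v x y where v: "a = t + v" and x: "p = t + x" and y: "q = v + y"
    using Pt unfolding P_def by (metis diff_add_inverse le_Suc_ex)
  have b: "b = x + y" using ab v x y by simp
  have "triangular x + triangular y + y * (p + 1) \<le> c"
  proof -
    consider "t = 0" | "y = 0" | t' y' where "t = Suc t'" "y = Suc y'"
      by (metis not0_implies_Suc)
    then show ?thesis
    proof cases
      case 1
      then show ?thesis
        using c2 triangular_add[of p "y + 1"] triangular_add[of y 1] x b
        by (simp add: triangular_Suc algebra_simps)
    next
      case 2
      then show ?thesis using c1 b by simp
    next
      case 3
      have "\<not> P t'" using least 3 by simp
      moreover have "a - t' = Suc v" using v 3 by simp
      ultimately have s: "s < triangular t' + triangular (Suc v) + Suc v * (p + 1)"
        using 3 v x y unfolding P_def by (simp del: mult_Suc)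
      \<comment> \<open>Minimality bounds \<open>s\<close>, hence \<open>c\<close> through the total; the quadratic terms combine to the
        products measuring the overlap of consecutive intervals.\<close>
      have key: "triangular x + triangular y + y * (p + 1) + t' * x + v * y' \<le> c + 1"
      proof -
        have "2 * (s + c) = 2 * triangular p + 2 * triangular q + 2 * (q * (p + 1))"
          using total' by simp
        moreover have "2 * s + 2 \<le> 2 * triangular t' + 2 * triangular (Suc v) + 2 * (Suc v * (p + 1))"
          using s by simp
        ultimately have "2 * triangular x + 2 * triangular y + 2 * (y * (p + 1)) + 2 * (t' * x) + 2 * (v * y')
            \<le> 2 * c + 2"
          unfolding double_triangular using x y 3 by (simp add: algebra_simps)
        then show ?thesis by simp
      qed
      show ?thesis
      proof (cases "t' * x + v * y' = 0")
        case False
        then show ?thesis using key by linarith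
      next
        case True
        then have "(t' = 0 \<or> x = 0) \<and> (v = 0 \<or> y' = 0)" by simp
        moreover have "\<not> (t' = 0 \<and> v = 0)" using v 3 \<open>2 \<le> a\<close> by auto
        moreover have "v \<noteq> 0 \<or> x \<noteq> 0" using v x \<open>a \<noteq> p\<close> by auto
        moreover have "\<not> (x = 0 \<and> y' = 0)" using b 3 \<open>2 \<le> b\<close> by auto
        ultimately have "t' = 0" "y' = 0" by auto
        then have "b = p" "p = Suc x" "y = 1" using 3 b x by auto
        then show ?thesis using c1 by (simp add: triangular_Suc)
      qed
    qed
  qed
  moreover have "triangular t + triangular v + v * (p + 1) \<le> s"
    using Pt v unfolding P_def by simp
  ultimately show thesis using that v x y by metis
qed

lemma subset_sum_with_hole:
  assumes "a + b = p + q" "2 \<le> a" "2 \<le> b" "a \<noteq> p"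
    and "triangular a \<le> s" "triangular (a + 1) \<le> s + (p + 1)"
    and "triangular b + 2 \<le> c" "triangular (b + 1) + 2 \<le> c + (p + 1)"
    and total: "s + c + (p + 1) = triangular (p + 1 + q)"
  shows "\<exists>A\<subseteq>{1..p + 1 + q} - {p + 1}. card A = a \<and> \<Sum>A = s"
proof -
  obtain t v x y where sz: "t + v = a" "t + x = p" "v + y = q"
    and s: "triangular t + triangular v + v * (p + 1) \<le> s"
    and c: "triangular x + triangular y + y * (p + 1) \<le> c"
    using split_sizes[OF assms] by blast
  have total': "s + c = triangular p + triangular q + v * (p + 1) + y * (p + 1)"
    using total triangular_add[of "p + 1" q] triangular_add[of p 1] sz(3)
    by (auto simp add: triangular_Suc algebra_simps)
  define r where "r = s - (triangular t + triangular v + v * (p + 1))"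
  have px: "triangular t + triangular x \<le> triangular p"
    and qy: "triangular v + triangular y \<le> triangular q"
    using sz triangular_add[of t x] triangular_add[of v y] by auto
  obtain r1 r2 where r: "r = r1 + r2"
    and r1: "triangular t + r1 + triangular x \<le> triangular p"
    and r2: "triangular v + r2 + triangular y \<le> triangular q"
  proof
    define m where "m = triangular p - triangular t - triangular x"
    show "r = min r m + (r - min r m)" by simp
    show "triangular t + min r m + triangular x \<le> triangular p"
      using px unfolding m_def by linarith
    show "triangular v + (r - min r m) + triangular y \<le> triangular q"
      using px qy c s total' unfolding m_def r_def by linarith
  qed
  obtain A1 where A1: "A1 \<subseteq> {1..p}" "card A1 = t" "\<Sum>A1 = triangular t + r1"
    using subset_sum_interval[of t p "triangular t + r1"] r1 sz by auto
  obtain A2 where A2: "A2 \<subseteq> {1..q}" "card A2 = v" "\<Sum>A2 = triangular v + r2"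
    using subset_sum_interval[of v q "triangular v + r2"] r2 sz by auto
  have fin: "finite A1" "finite A2" using A1 A2 finite_subset by blast+
  define A where "A = A1 \<union> (+) (p + 1) ` A2"
  have disj: "A1 \<inter> (+) (p + 1) ` A2 = {}" using A1 by auto
  have "A \<subseteq> {1..p + 1 + q} - {p + 1}" using A1 A2 by (auto simp: A_def)
  moreover have "card A = a"
    unfolding A_def card_Un_disjoint[OF fin(1) finite_imageI[OF fin(2)] disj]
    using A1 A2 sz by (simp only: card_image[OF inj_on_add])
  moreover have "\<Sum>A = s"
  proof -
    have "\<Sum>A = \<Sum>A1 + (\<Sum>x\<in>A2. (p + 1) + x)"
      unfolding A_def sum.union_disjoint[OF fin(1) finite_imageI[OF fin(2)] disj]
      by (simp only: sum.reindex[OF inj_on_add] o_def)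
    also have "\<dots> = triangular t + r1 + (v * (p + 1) + (triangular v + r2))"
      using A1 A2 by (simp only: sum.distrib sum_constant of_nat_id distrib_left)
    also have "\<dots> = s" using r s unfolding r_def by linarith
    finally show ?thesis .
  qed
  ultimately show ?thesis by blast
qed

section \<open>Permutations consistent with one weighing\<close>

lemma rearrangement:
  assumes w: "weighing n (L, R)"
    and A: "A \<subseteq> {1..n}" "B \<subseteq> {1..n}" "A \<inter> B = {}" "card A = card L" "card B = card R"
  obtains s where "s permutes {1..n}" "s ` L = A" "s ` R = B"
proof -
  define U where "U = {1..n}"
  have LR: "L \<subseteq> U" "R \<subseteq> U" "L \<inter> R = {}" "A \<subseteq> U" "B \<subseteq> U"
    using w A by (auto simp: weighing_def U_def)
  have fin: "finite U" "finite L" "finite R" "finite A" "finite B"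
    using LR finite_subset unfolding U_def by blast+
  obtain f where f: "bij_betw f L A" using fin A finite_same_card_bij by metis
  obtain g where g: "bij_betw g R B" using fin A finite_same_card_bij by metis
  have "card (U - (L \<union> R)) = card (U - (A \<union> B))"
    using fin LR A by (simp add: card_Diff_subset card_Un_disjoint)
  then obtain h where h: "bij_betw h (U - (L \<union> R)) (U - (A \<union> B))"
    using fin finite_same_card_bij by (metis finite_Diff)
  define s where "s x = (if x \<in> L then f x else if x \<in> R then g x
     else if x \<in> U then h x else x)" for x
  have sL: "bij_betw s L A"
    using f by (rule bij_betw_cong[THEN iffD1, rotated]) (simp add: s_def)
  have sR: "bij_betw s R B"
    using g by (rule bij_betw_cong[THEN iffD1, rotated]) (use LR in \<open>auto simp: s_def\<close>)
  have sO: "bij_betw s (U - (L \<union> R)) (U - (A \<union> B))"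
    using h by (rule bij_betw_cong[THEN iffD1, rotated]) (auto simp: s_def)
  have "bij_betw s (L \<union> R \<union> (U - (L \<union> R))) (A \<union> B \<union> (U - (A \<union> B)))"
    using A by (intro bij_betw_combine sL sR sO) auto
  moreover have "L \<union> R \<union> (U - (L \<union> R)) = U" "A \<union> B \<union> (U - (A \<union> B)) = U"
    using LR by auto
  ultimately have "s permutes U"
    using LR by (intro bij_imp_permutes) (auto simp: s_def)
  then show thesis
    using that sL sR unfolding U_def by (auto simp: bij_betw_def)
qed

lemma outcome_permutation:
  assumes "s permutes {1..n}"
  shows "outcome s (L, R) = sgn (int (\<Sum>(s ` L)) - int (\<Sum>(s ` R)))"
proof -
  have "inj_on s X" for X
    using permutes_inj[OF assms] by (simp add: inj_on_def)
  then show ?thesis by (simp add: outcome_def sum.reindex)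
qed

lemma outcome_id: "outcome id (L, R) = sgn (int (\<Sum>L) - int (\<Sum>R))"
  by (simp add: outcome_def)

lemma outcome_swap: "outcome s (R, L) = - outcome s (L, R)"
  unfolding outcome_def fst_conv snd_conv by (metis minus_diff_eq idom_abs_sgn_class.sgn_minus)

lemma proves_weight_swap:
  "proves_weight n [(L, R)] k \<Longrightarrow> proves_weight n [(R, L)] k"
  by (auto simp: proves_weight_def consistent_def weighing_def outcome_swap[of _ R L])

lemma proves_weight_rearranged:
  assumes p: "proves_weight n [(L, R)] k"
    and A: "A \<subseteq> {1..n}" "B \<subseteq> {1..n}" "A \<inter> B = {}" "card A = card L" "card B = card R"
    and out: "sgn (int (\<Sum>A) - int (\<Sum>B)) = sgn (int (\<Sum>L) - int (\<Sum>R))"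
  shows "k \<in> A \<longleftrightarrow> k \<in> L" and "k \<in> B \<longleftrightarrow> k \<in> R"
proof -
  have "weighing n (L, R)" using p by (simp add: proves_weight_def)
  from rearrangement[OF this A] obtain s
    where s: "s permutes {1..n}" "s ` L = A" "s ` R = B" .
  have "consistent n [(L, R)] s"
    using s out by (simp add: consistent_def outcome_permutation outcome_id)
  then have "s k = k" using p by (simp add: proves_weight_def)
  then show "k \<in> A \<longleftrightarrow> k \<in> L" "k \<in> B \<longleftrightarrow> k \<in> R"
    using s permutes_inj[OF s(1)] by (metis inj_image_mem_iff)+
qed

text \<open>Exchanging \<open>k\<close> with another coin of its class changes neither cup as a set of weights.\<close>
lemma proved_coin_alone:
  assumes p: "proves_weight n [(L, R)] k"
    and y: "y \<in> {1..n}" "y \<in> L \<longleftrightarrow> k \<in> L" "y \<in> R \<longleftrightarrow> k \<in> R"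
  shows "y = k"
proof -
  have k: "k \<in> {1..n}" using p by (simp add: proves_weight_def)
  have t: "transpose k y permutes {1..n}" using k y by (intro permutes_swap_id)
  have "transpose k y ` L = L" "transpose k y ` R = R"
    using y by (simp_all add: transpose_image_eq)
  then have "consistent n [(L, R)] (transpose k y)"
    using t by (simp add: consistent_def outcome_permutation outcome_id)
  then have "transpose k y k = k" using p unfolding proves_weight_def by blast
  then show ?thesis by simp
qed

lemma proves_weightD:
  assumes "proves_weight n [(L, R)] k"
  shows "L \<subseteq> {1..n}" "R \<subseteq> {1..n}" "L \<inter> R = {}" "L \<noteq> {}" "R \<noteq> {}" "k \<in> {1..n}"
    "finite L" "finite R" "0 \<notin> L" "0 \<notin> R"
proof -
  show "L \<subseteq> {1..n}" "R \<subseteq> {1..n}" "L \<inter> R = {}" "L \<noteq> {}" "R \<noteq> {}" "k \<in> {1..n}"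
    using assms by (simp_all add: proves_weight_def weighing_def)
  then show "finite L" "finite R" "0 \<notin> L" "0 \<notin> R"
    using finite_subset by fastforce+
qed

section \<open>The proved coin is alone in a cup\<close>

text \<open>
With the weights \<open>{1..a}\<close> in the left cup, every weight above \<open>T\<^sub>a\<close> is possible for the right coin.
\<close>
lemma heavy_single_coin:
  assumes p: "proves_weight n [(L, {k})] k" and lt: "\<Sum>L < k"
  shows "n = triangular (card L) + 1"
proof -
  note D = proves_weightD[OF p]
  define a where "a = card L"
  have aT: "a \<le> triangular a" by (cases a) (simp_all add: triangular_Suc)
  have k_unique: "r = k" if "triangular a < r" "r \<le> n" for r
  proof -
    have "k \<in> {r}"
      using that D(6) lt aT
      by (subst proves_weight_rearranged(2)[OF p, of "{1..a}" "{r}"])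
        (auto simp: sum_atLeast1[simplified] a_def simp del: of_nat_sum)
    then show ?thesis by simp
  qed
  have "triangular a \<le> \<Sum>L" unfolding a_def using D by (intro triangular_le_sum)
  then have "triangular a < k" "k \<le> n" using lt D by auto
  then have "triangular a + 1 = k" "n = k"
    using k_unique[of "triangular a + 1"] k_unique[of n] by simp_all
  then show ?thesis by (simp add: a_def)
qed

text \<open>
Both \<open>1 + \<dots> + a = T\<^sub>a\<close> and \<open>1 + \<dots> + (a - 1) + (a + 1) = T\<^sub>a + 1\<close> balance, so \<open>n\<close> must be too small
for the second equation.
\<close>
lemma balanced_single_coin:
  assumes p: "proves_weight n [(L, {k})] k" and eq: "\<Sum>L = k"
  shows "n = triangular (card L)"
proof -
  note D = proves_weightD[OF p]
  define a where "a = card L"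
  have "a \<noteq> 1"
  proof
    assume "a = 1"
    then obtain x where "L = {x}" unfolding a_def by (auto simp: card_1_singleton_iff)
    then show False using eq D by simp
  qed
  moreover have "a \<noteq> 0" using D by (simp add: a_def)
  \<comment> \<open>For \<open>a \<ge> 2\<close> the weights \<open>T\<^sub>a\<close> and \<open>T\<^sub>a + 1\<close> lie outside the opposite sets.\<close>
  ultimately obtain c where c: "a = Suc (Suc c)" by (metis One_nat_def not0_implies_Suc)
  have "triangular a \<le> \<Sum>L" unfolding a_def using D by (intro triangular_le_sum)
  then have le: "triangular a \<le> k" "k \<le> n" using eq D by auto
  have Ta: "a < triangular a" using c by (simp add: triangular_Suc)
  have "k \<in> {triangular a}"
    using le eq Ta
    by (subst proves_weight_rearranged(2)[OF p, of "{1..a}" "{triangular a}"])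
      (auto simp: sum_atLeast1[simplified] a_def simp del: of_nat_sum)
  moreover have "k \<in> {triangular a + 1}" if "triangular a + 1 \<le> n"
    using that le eq Ta c
    by (subst proves_weight_rearranged(2)[OF p, of "insert (a + 1) {1..Suc c}" "{triangular a + 1}"])
      (auto simp: sum_atLeast1[simplified] a_def[symmetric] triangular_Suc simp del: of_nat_sum)
  ultimately show ?thesis using le by (fastforce simp: a_def)
qed

text \<open>
For \<open>n \<ge> 3\<close> the lighter single coin can weigh 1 or 2: against the coin of weight 3, or against
\<open>{2, 3, \<dots>}\<close> and \<open>{1, 3, \<dots>}\<close>.
\<close>
lemma light_single_coin:
  assumes p: "proves_weight n [(L, {k})] k" and gt: "k < \<Sum>L"
  shows "n = 2"
proof -
  note D = proves_weightD[OF p]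
  have card: "card L \<noteq> 0" using D by simp
  have "card (insert k L) \<le> n"
    using card_mono[of "{1..n}" "insert k L"] D by simp
  then have n: "Suc (card L) \<le> n" using D by simp
  have move: "k = r" if r: "r \<in> {1..n}" "r \<notin> A" and A: "A \<subseteq> {1..n}" "card A = card L" "r < \<Sum>A" for A r
  proof -
    have "k \<in> {r}"
      using that gt
      by (subst proves_weight_rearranged(2)[OF p, of A "{r}"]) (auto simp del: of_nat_sum)
    then show ?thesis by simp
  qed
  show ?thesis
  proof (rule ccontr)
    assume "n \<noteq> 2"
    with n card have n3: "3 \<le> n" by linarith
    show False
    proof (cases "card L = 1")
      case True
      then have "k = 1" using n3 by (intro move[of 1 "{3}"]) auto
      moreover have "k = 2" using True n3 by (intro move[of 2 "{3}"]) auto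
      ultimately show False by simp
    next
      case False
      then obtain c where c: "card L = Suc (Suc c)" using card by (metis One_nat_def not0_implies_Suc)
      have "k = 1"
        using n c by (intro move[of 1 "insert 2 (insert 3 {4..c + 3})"]) auto
      moreover have "k = 2"
        using n c by (intro move[of 2 "insert 1 (insert 3 {4..c + 3})"]) auto
      ultimately show False by simp
    qed
  qed
qed

section \<open>The proved coin is the only one aside\<close>

lemma complement_sum:
  assumes "A \<subseteq> {1..n} - {j}" "j \<in> {1..n}"
  shows "\<Sum>({1..n} - {j} - A) + \<Sum>A + j = triangular n"
    and "card ({1..n} - {j} - A) + card A + 1 = n"
proof -
  have "\<Sum>({1..n} - {j} - A) + \<Sum>A = \<Sum>({1..n} - {j})"
    using assms by (intro sum.subset_diff[symmetric]) auto
  moreover have "\<Sum>({1..n} - {j}) + j = triangular n"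
    using sum.remove[of "{1..n}" j "\<lambda>x. x"] assms by (simp add: sum_atLeast1[simplified])
  ultimately show "\<Sum>({1..n} - {j} - A) + \<Sum>A + j = triangular n" by simp
  have "finite A" using assms finite_subset by blast
  moreover have "card A \<le> card ({1..n} - {j})" using assms by (intro card_mono) auto
  ultimately show "card ({1..n} - {j} - A) + card A + 1 = n"
    using assms by (simp add: card_Diff_subset) linarith
qed

lemma proved_coin_aside:
  assumes p: "proves_weight n [(L, R)] k" and k: "k \<notin> L" "k \<notin> R"
  shows "R = {1..n} - {k} - L"
    and "\<Sum>R + \<Sum>L + k = triangular n" "card R + card L + 1 = n"
proof -
  note D = proves_weightD[OF p]
  show R: "R = {1..n} - {k} - L"
    using D k proved_coin_alone[OF p] by blast
  show "\<Sum>R + \<Sum>L + k = triangular n" "card R + card L + 1 = n"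
    using complement_sum[of L n k] D k unfolding R[symmetric] by auto
qed

text \<open>
With one coin aside, the set \<open>A\<close> for the left cup determines everything, and the right
cup exceeds it by \<open>T\<^sub>n - (2 \<Sum>A + j)\<close>.
\<close>
lemma aside_unique:
  assumes p: "proves_weight n [(L, R)] k" and k: "k \<notin> L" "k \<notin> R"
    and j: "j \<in> {1..n}" and A: "A \<subseteq> {1..n} - {j}" "card A = card L"
    and out: "sgn (int (triangular n) - int (2 * \<Sum>A + j)) = sgn (int (\<Sum>R) - int (\<Sum>L))"
  shows "j = k"
proof -
  define B where "B = {1..n} - {j} - A"
  have B: "\<Sum>B + \<Sum>A + j = triangular n" "card B + card A + 1 = n"
    unfolding B_def using complement_sum[OF A(1) j] by auto
  have "sgn (int (\<Sum>B) - int (\<Sum>A)) = sgn (int (\<Sum>R) - int (\<Sum>L))"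
    using out unfolding B(1)[symmetric] by simp
  then have "sgn (int (\<Sum>A) - int (\<Sum>B)) = sgn (int (\<Sum>L) - int (\<Sum>R))"
    by (metis minus_diff_eq idom_abs_sgn_class.sgn_minus)
  moreover have "card B = card R"
    using B(2) proved_coin_aside(3)[OF p k] A(2) by linarith
  ultimately have "k \<in> A \<longleftrightarrow> k \<in> L" "k \<in> B \<longleftrightarrow> k \<in> R"
    using proves_weight_rearranged[OF p, of A B] A by (auto simp: B_def)
  then show ?thesis using k proves_weightD(6)[OF p] by (auto simp: B_def)
qed

text \<open>
The sets \<open>{1..a}\<close>, with \<open>a + 1\<close> or \<open>a + 2\<close> aside, give the differences \<open>T\<^sub>n - (a + 1)\<^sup>2\<close> and one less. The
first is positive because it is the largest difference possible; so the second must not be.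
\<close>
lemma unbalanced_aside:
  assumes p: "proves_weight n [(L, R)] k" and k: "k \<notin> L" "k \<notin> R" and lt: "\<Sum>L < \<Sum>R"
  shows "triangular n = (card L + 1)^2 + 1"
proof -
  note D = proves_weightD[OF p]
  define a where "a = card L"
  note aside = proved_coin_aside[OF p k, folded a_def]
  have sq: "(a + 1)^2 = 2 * triangular a + (a + 1)"
    unfolding double_triangular by (simp add: power2_eq_square)
  have move: "j = k" if "a < j" "j \<le> n" "2 * triangular a + j < triangular n" for j
    using that lt
    by (intro aside_unique[OF p k, of j "{1..a}"]) (auto simp: sum_atLeast1[simplified] a_def simp del: of_nat_sum)
  have "(a + 1)^2 \<le> 2 * \<Sum>L + k"
    using square_le_double_sum[of L k] D k unfolding a_def by auto
  also have "\<dots> < triangular n" using lt aside by simp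
  finally have less: "(a + 1)^2 < triangular n" .
  have "card R \<noteq> 0" using D by simp
  then have n: "a + 2 \<le> n" using aside(3) by linarith
  have "a + 1 = k" using n less sq by (intro move) auto
  then have "\<not> (a + 1)^2 + 1 < triangular n" using move[of "a + 2"] n sq by auto
  with less show ?thesis by (simp add: a_def)
qed

text \<open>
Write \<open>T\<^sub>n = (a + 1)\<^sup>2 + e + 2 m\<close> with \<open>e = 1\<close> or \<open>e = 2\<close>. Balance with \<open>j\<close> aside needs
\<open>2 s + j = T\<^sub>n\<close>; for \<open>j = a + 1 \<mp> e\<close> this gives \<open>s = T\<^sub>a + m + e\<close> and \<open>s = T\<^sub>a + m\<close>. These are
\<open>m\<close> above the least sum of \<open>a\<close> weights avoiding \<open>j\<close>, and since \<open>b \<le> a\<close> they stay clear of the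
top of the range (\<open>big\<close>), so both occur. Not using \<open>j = a + 1\<close> matters: with
that hole the sum \<open>T\<^sub>a + 1\<close> does not occur.
\<close>
lemma balanced_aside_large:
  assumes p: "proves_weight n [(L, R)] k" and k: "k \<notin> L" "k \<notin> R" and eq: "\<Sum>L = \<Sum>R"
    and cards: "card R \<le> card L" "2 \<le> card R"
  shows "triangular n = (card L + 1)^2"
proof (rule ccontr)
  assume neq: "triangular n \<noteq> (card L + 1)^2"
  note D = proves_weightD[OF p]
  define a b where "a = card L" and "b = card R"
  note aside = proved_coin_aside[OF p k, folded a_def b_def]
  have sq: "(a + 1)^2 = 2 * triangular a + (a + 1)"
    unfolding double_triangular by (simp add: power2_eq_square)
  have n: "n = a + b + 1" using aside by simp
  have ab: "b \<le> a" "2 \<le> b" using cards by (simp_all add: a_def b_def)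
  have "(a + 1)^2 \<le> 2 * \<Sum>L + k"
    using square_le_double_sum[of L k] D k unfolding a_def by auto
  also have "\<dots> = triangular n" using eq aside by simp
  finally have "(a + 1)^2 < triangular n" using neq by (simp add: a_def)
  then obtain d where d: "triangular n = (a + 1)^2 + Suc d"
    by (metis less_natE add_Suc_right)
  define e m where "e = 1 + d mod 2" and "m = d div 2"
  have em: "triangular n = (a + 1)^2 + e + 2 * m" "1 \<le> e" "e \<le> 2"
    using d by (simp_all add: e_def m_def)
  have big: "triangular b + 2 \<le> triangular a + m"
  proof (cases "a = b")
    case True
    have "2 * triangular n = 2 * ((a + 1)^2 + a * (a + 1))"
      unfolding double_triangular n True by (simp add: power2_eq_square algebra_simps)
    moreover have "2 * 3 \<le> a * (a + 1)" using ab True by (intro mult_le_mono) auto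
    moreover have "e + 2 * m = a * (a + 1)" using calculation(1) em(1) by (simp del: mult_Suc_right)
    ultimately have "2 \<le> m" using em by linarith
    then show ?thesis using True by simp
  next
    case False
    then have "triangular (Suc b) \<le> triangular a" using ab by (intro triangular_mono) simp
    then show ?thesis using ab by (simp add: triangular_Suc)
  qed
  have move: "p' + 1 = k" if pq: "p' + q = a + b" "a \<noteq> p'" and s: "2 * s + (p' + 1) = triangular n"
    "triangular a + m \<le> s" "triangular (a + 1) + m \<le> s + (p' + 1)" for p' q s
  proof -
    have "\<exists>A\<subseteq>{1..p' + 1 + q} - {p' + 1}. card A = a \<and> \<Sum>A = s"
      using ab pq s big n
      by (intro subset_sum_with_hole[of a b p' q s s]) (auto simp: triangular_Suc)
    moreover have "p' + 1 + q = n" using pq n by simp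
    ultimately obtain A where A: "A \<subseteq> {1..n} - {p' + 1}" "card A = a" "\<Sum>A = s" by auto
    then show ?thesis
      using s eq pq n by (intro aside_unique[OF p k, of "p' + 1" A]) (auto simp: a_def)
  qed
  have "a - e + 1 = k"
    using ab em sq by (intro move[of "a - e" "b + e" "triangular a + m + e"]) (auto simp: triangular_Suc)
  moreover have "a + e + 1 = k"
    using ab em sq by (intro move[of "a + e" "b - e" "triangular a + m"]) (auto simp: triangular_Suc)
  ultimately show False using em ab by simp
qed

text \<open>A single coin balancing all but one of the others forces \<open>T\<^sub>n = 2 r + k < 3 n\<close>.\<close>
lemma balanced_aside_small:
  assumes p: "proves_weight n [(L, R)] k" and k: "k \<notin> L" "k \<notin> R" and eq: "\<Sum>L = \<Sum>R"
    and R: "card R = 1"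
  shows "n = 3 \<or> n = 4"
proof -
  note D = proves_weightD[OF p] and aside = proved_coin_aside[OF p k]
  obtain r where r: "R = {r}" using R by (auto simp: card_1_singleton_iff)
  have tot: "2 * r + k = triangular n" using aside(2) eq r by simp
  have rk: "r \<in> {1..n}" "k \<in> {1..n}" "r \<noteq> k" using D r k by auto
  have n5: "n \<le> 5"
  proof (rule ccontr)
    assume "\<not> n \<le> 5"
    then have "6 * n \<le> n * n" by simp
    also have "n * n < 2 * (2 * r + k)"
      unfolding tot double_triangular using rk by simp
    also have "\<dots> \<le> 6 * n" using rk by simp
    finally show False by simp
  qed
  have "card L \<noteq> 0" using D by simp
  then have "3 \<le> n" using aside R by linarith
  moreover have "n \<noteq> 5"
  proof
    assume "n = 5"
    then have "2 * r + k = 15" using tot by (simp add: triangular_def)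
    then show False using rk \<open>n = 5\<close> by simp
  qed
  ultimately show ?thesis using n5 by auto
qed

section \<open>Necessity\<close>

text \<open>
The cases \<open>n = 3\<close> and \<open>n = 4\<close> left over by \<open>balanced_aside_small\<close> are \<open>T\<^sub>2\<close> and \<open>T\<^sub>2 + 1\<close>. In the other
cases the two cups are interchanged where needed.
\<close>
lemma single_weighing_necessary:
  assumes p: "proves_weight n [(L, R)] k"
  shows "(\<exists>i. n = triangular i) \<or> n = 2 \<or> (\<exists>i. n = triangular i + 1) \<or>
    (\<exists>k. triangular n = k^2 + 1) \<or> (\<exists>k. triangular n = k^2)"
proof -
  have in_right: ?thesis if p: "proves_weight n [(L, R)] k" and k: "k \<in> R" for L R
  proof -
    have "R = {k}" 
      using k proved_coin_alone[OF p] proves_weightD[OF p] by blast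
    then have "proves_weight n [(L, {k})] k" using p by simp
    then show ?thesis
      using heavy_single_coin balanced_single_coin light_single_coin
      by (metis linorder_neqE_nat)
  qed
  have aside: ?thesis if p: "proves_weight n [(L, R)] k" and k: "k \<notin> L" "k \<notin> R"
    and cards: "card R \<le> card L" for L R
  proof (cases "\<Sum>L = \<Sum>R")
    case True
    have "card R \<noteq> 0" using proves_weightD[OF p] by simp
    then consider "card R = 1" | "2 \<le> card R" by linarith
    then show ?thesis
    proof cases
      case 1
      have "3 = triangular 2" "4 = triangular 2 + 1" by (simp_all add: triangular_def)
      then show ?thesis using balanced_aside_small[OF p k True 1] by metis
    next
      case 2
      then show ?thesis using balanced_aside_large[OF p k True cards] by blast
    qed
  next
    case False
    then show ?thesis
      using unbalanced_aside[OF p k] unbalanced_aside[OF proves_weight_swap[OF p] k(2,1)]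
      by (metis linorder_neqE_nat)
  qed
  note p' = proves_weight_swap[OF p]
  consider "k \<in> R" | "k \<in> L" | "k \<notin> L" "k \<notin> R" "card R \<le> card L"
    | "k \<notin> L" "k \<notin> R" "card L \<le> card R"
    by linarith
  then show ?thesis
  proof cases
    case 1
    then show ?thesis by (rule in_right[OF p])
  next
    case 2
    then show ?thesis by (rule in_right[OF p'])
  next
    case 3
    then show ?thesis by (rule aside[OF p])
  next
    case 4
    then show ?thesis by (intro aside[OF p'])
  qed
qed

section \<open>The weighings that work\<close>

text \<open>
The \<open>i\<close> coins on the left weigh at least \<open>T\<^sub>i\<close>, so the outcome forces the single coin to weigh
at least \<open>n\<close>.
\<close>
lemma heavy_coin_sufficient:
  assumes n: "2 \<le> n" "n = triangular i \<or> n = triangular i + 1"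
  shows "proves_weight n [({1..i}, {n})] n"
proof -
  have "i \<noteq> 0" using n by (intro notI) simp
  have "i < n"
  proof (cases "i \<le> 1")
    case True
    with \<open>i \<noteq> 0\<close> have "i = 1" by simp
    then show ?thesis using n by simp
  next
    case False
    obtain c where "i = Suc (Suc c)" using that[of "i - 2"] False by simp
    then have "i < triangular i" by (simp add: triangular_Suc)
    then show ?thesis using n by auto
  qed
  have "s n = n" if s: "consistent n [({1..i}, {n})] s" for s
  proof -
    have perm: "s permutes {1..n}" using s by (simp add: consistent_def)
    have out: "sgn (int (\<Sum>(s ` {1..i})) - int (s n)) = sgn (int (triangular i) - int n)"
      using s outcome_permutation[OF perm, of "{1..i}" "{n}"]
      by (simp add: consistent_def outcome_id sum_atLeast1[simplified])
    have "s x \<in> {1..n}" if "x \<in> {1..i}" for x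
      using permutes_in_image[OF perm, of x] that \<open>i < n\<close> by simp
    then have "0 \<notin> s ` {1..i}" by fastforce
    then have "triangular i \<le> \<Sum>(s ` {1..i})"
      using triangular_le_sum[of "s ` {1..i}"] card_image[of s "{1..i}"] permutes_inj_on[OF perm]
      by auto
    moreover have "s n \<le> n" using permutes_in_image[OF perm, of n] n by auto
    ultimately show ?thesis
      using out n(2) by (auto simp: sgn_if simp del: of_nat_sum split: if_splits)
  qed
  then show ?thesis
    using \<open>i \<noteq> 0\<close> \<open>i < n\<close> by (auto simp: proves_weight_def weighing_def)
qed

lemma tail_sum: "k \<le> n \<Longrightarrow> \<Sum>{k + 1..n} + triangular k = triangular n"
  using sum.ub_add_nat[of 1 k "\<lambda>x. x" "n - k"] by (simp add: sum_atLeast1[simplified])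

text \<open>
If the coin aside weighs \<open>j\<close>, then \<open>square_le_double_sum\<close> bounds the excess of the right cup by
\<open>T\<^sub>n - k\<^sup>2 - \<bar>j - k\<bar>\<close>, whereas the observed outcome requires at least \<open>T\<^sub>n - k\<^sup>2\<close>.
\<close>
lemma middle_coin:
  assumes n: "2 \<le> n" "triangular n = k^2 \<or> triangular n = k^2 + 1"
  shows "1 < k" "k < n"
    and "int (\<Sum>{1..k - 1}) - int (\<Sum>{k + 1..n}) = int (k^2) - int (triangular n)"
    and "proves_weight n [({1..k - 1}, {k + 1..n})] k"
proof -
  have "3 \<le> triangular n"
    using triangular_mono[OF n(1)] by (simp add: triangular_def)
  then show k: "1 < k"
    using n(2) by (cases "k = 0 \<or> k = 1") (auto simp: power2_eq_square)
  have "n * 2 \<le> n * n" using n(1) by (intro mult_le_mono) auto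
  then have "2 * triangular n < 2 * n^2" 
    unfolding double_triangular using n(1) by (simp add: power2_eq_square)
  then have "k^2 < n^2" using n(2) by auto
  then show kn: "k < n" by (rule power_less_imp_less_base) simp
  obtain c where c: "k = Suc c" using k by (cases k) auto
  have sq: "k^2 = 2 * triangular c + k"
    unfolding double_triangular c by (simp add: power2_eq_square)
  have "\<Sum>{1..k - 1} = triangular c" using c sum_atLeast1 by simp
  moreover have "\<Sum>{k + 1..n} + (triangular c + k) = triangular n"
    using tail_sum[of k n] kn c by (simp add: triangular_Suc)
  ultimately show diff: "int (\<Sum>{1..k - 1}) - int (\<Sum>{k + 1..n}) = int (k^2) - int (triangular n)"
    using sq by linarith
  have "s k = k" if s: "consistent n [({1..k - 1}, {k + 1..n})] s" for s
  proof -
    have perm: "s permutes {1..n}" using s by (simp add: consistent_def)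
    have inj: "inj_on s X" for X using permutes_inj_on[OF perm] .
    define A B where "A = s ` {1..k - 1}" and "B = s ` {k + 1..n}"
    have "s x \<in> {1..n} - {s k}" if "x \<in> {1..k - 1}" for x
      using that permutes_in_image[OF perm, of x] inj_eq[OF permutes_inj[OF perm], of x k] k kn
      by auto
    then have A: "A \<subseteq> {1..n} - {s k}" unfolding A_def by (rule image_subsetI)
    have sk: "s k \<in> {1..n}" using permutes_in_image[OF perm] kn k by auto
    have "{k + 1..n} = {1..n} - {k} - {1..k - 1}" using k kn by auto
    then have "B = {1..n} - {s k} - A"
      unfolding A_def B_def using permutes_image[OF perm] permutes_inj[OF perm]
      by (simp add: image_set_diff)
    then have tot: "\<Sum>B + \<Sum>A + s k = triangular n" using complement_sum[OF A sk] by simp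
    have "finite A" "0 \<notin> A" "s k \<notin> A" "0 < s k" "card A + 1 = k"
      using A sk finite_subset card_image[OF inj] k by (auto simp: A_def)
    then have "k^2 + nat \<bar>int (s k) - int k\<bar> \<le> 2 * \<Sum>A + s k"
      using square_le_double_sum[of A "s k"] by simp
    moreover have "sgn (int (\<Sum>A) - int (\<Sum>B)) = sgn (int (k^2) - int (triangular n))"
      using s outcome_permutation[OF perm] diff
      by (simp add: consistent_def outcome_id A_def B_def)
    ultimately show ?thesis
      using tot n(2) by (auto simp: sgn_if simp del: of_nat_sum split: if_splits)
  qed
  then show "proves_weight n [({1..k - 1}, {k + 1..n})] k"
    using k kn by (auto simp: proves_weight_def weighing_def)
qed

lemma two_coins: "proves_weight 2 [({1}, {2})] 1" "proves_weight 2 [({1}, {2})] 2"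
proof -
  have two: "{1..2::nat} = {1, 2}" by auto
  have "s 1 = 1 \<and> s 2 = 2" if "consistent 2 [({1}, {2})] s" for s
  proof -
    have perm: "s permutes {1, 2}" and "s 1 < s 2"
      using that by (simp_all add: consistent_def outcome_def two[simplified] sgn_if split: if_splits)
    then show ?thesis
      using permutes_in_image[OF perm, of 1] permutes_in_image[OF perm, of 2] by auto
  qed
  then show "proves_weight 2 [({1}, {2})] 1" "proves_weight 2 [({1}, {2})] 2"
    by (auto simp: proves_weight_def weighing_def)
qed

section \<open>The sequence\<close>

lemma no_weighing_no_proof:
  assumes "2 \<le> n" shows "\<not> proves_weight n [] k"
proof
  assume p: "proves_weight n [] k"
  then have k: "k \<in> {1..n}" by (simp add: proves_weight_def)
  define y :: nat where "y = (if k = 1 then 2 else 1)"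
  have y: "y \<in> {1..n}" "y \<noteq> k" using assms by (simp_all add: y_def)
  have "consistent n [] (transpose k y)"
    using k y by (simp add: consistent_def permutes_swap_id)
  then have "transpose k y k = k" using p by (auto simp: proves_weight_def)
  then show False using y by simp
qed

text \<open>
Comparing each coin with the next one proves the weight of the heaviest. Existence of some
proof is needed because a least element of an empty set of lengths would be unspecified.
\<close>
lemma proof_exists:
  assumes "1 \<le> n" shows "\<exists>ws. proves_weight n ws n"
proof
  let ?ws = "map (\<lambda>i. ({i}, {i + 1})) [1..<n]"
  have "s n = n" if s: "consistent n ?ws s" for s
  proof -
    have perm: "s permutes {1..n}" using s by (simp add: consistent_def)
    have step: "s i < s (i + 1)" if "i \<in> {1..<n}" for i
    proof -
      have "outcome s ({i}, {i + 1}) = outcome id ({i}, {i + 1})"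
        using s that by (simp add: consistent_def)
      then show ?thesis by (simp add: outcome_def sgn_if split: if_splits)
    qed
    have "i \<le> s i" if "1 \<le> i" "i \<le> n" for i
      using that
    proof (induction i rule: dec_induct)
      case base
      then show ?case using permutes_in_image[OF perm, of 1] by auto
    next
      case (step i)
      then show ?case using \<open>\<And>i. i \<in> {1..<n} \<Longrightarrow> s i < s (i + 1)\<close>[of i] by auto
    qed
    moreover have "s n \<le> n" using permutes_in_image[OF perm, of n] assms by auto
    ultimately show ?thesis using assms by (simp add: le_antisym)
  qed
  then show "proves_weight n ?ws n"
    using assms by (auto simp: proves_weight_def weighing_def)
qed

lemma baron_seq_1: "baron_seq 1 = 0"
proof -
  have "proves_weight 1 [] 1"
    by (auto simp: proves_weight_def consistent_def)
  then show ?thesis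
    unfolding baron_seq_def by (intro Least_eq_0) auto
qed

lemma baron_seq_eq_1_iff:
  assumes "1 \<le> n"
  shows "baron_seq n = 1 \<longleftrightarrow> (\<exists>w k. proves_weight n [w] k)"
proof (cases "n = 1")
  case True
  have "\<not> weighing 1 w" for w
  proof
    assume "weighing 1 w"
    then have "fst w = {1}" "snd w = {1}" "fst w \<inter> snd w = {}"
      unfolding weighing_def by auto
    then show False by simp
  qed
  then have "\<not> proves_weight 1 [w] k" for w k by (simp add: proves_weight_def)
  then show ?thesis using baron_seq_1 True by simp
next
  case False
  define P where "P m \<longleftrightarrow> (\<exists>ws k. length ws = m \<and> proves_weight n ws k)" for m
  have least: "baron_seq n = (LEAST m. P m)" by (simp add: baron_seq_def P_def)
  have "\<not> P 0" using no_weighing_no_proof False assms by (simp add: P_def)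
  have P1: "P 1 \<longleftrightarrow> (\<exists>w k. proves_weight n [w] k)"
    by (auto simp: P_def length_Suc_conv)
  have "\<exists>m. P m" using proof_exists[OF assms] by (auto simp: P_def)
  then have "P (baron_seq n)" unfolding least by (rule LeastI_ex)
  moreover have "baron_seq n = 1" if "P 1"
    unfolding least using that \<open>\<not> P 0\<close>
    by (intro Least_equality) (auto simp: Suc_le_eq intro: Nat.gr0I)
  ultimately show ?thesis using P1 by metis
qed

lemma baron_seq_eq_1_iff_cases:
  assumes n: "2 \<le> n"
  shows "baron_seq n = 1 \<longleftrightarrow> (\<exists>i. n = triangular i) \<or> n = 2 \<or> (\<exists>i. n = triangular i + 1) \<or>
    (\<exists>k. triangular n = k^2 + 1) \<or> (\<exists>k. triangular n = k^2)" (is "_ \<longleftrightarrow> ?cases")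
proof -
  have "\<exists>w k. proves_weight n [w] k" if ?cases
    using that heavy_coin_sufficient[OF n] two_coins middle_coin(4)[OF n] by blast
  moreover have ?cases if "proves_weight n [w] k" for w k
    using that single_weighing_necessary by (cases w) blast
  ultimately show ?thesis using baron_seq_eq_1_iff n by auto
qed

lemma triangular_less_imp_less: "triangular i < triangular j \<Longrightarrow> i < j"
  using triangular_mono by (meson leD leI)

text \<open>For \<open>n \<le> 92\<close> it suffices to look at \<open>T\<^sub>i\<close> with \<open>i < 14\<close> and at the squares below \<open>66\<^sup>2 > T\<^sub>9\<^sub>2\<close>.\<close>
lemma baron_seq_table:
  "{n \<in> {1..92}. baron_seq n = 1} =
     {2, 3, 4, 6, 7, 8, 10, 11, 15, 16, 21, 22, 25, 28, 29, 36, 37, 45, 46, 49,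
      55, 56, 66, 67, 78, 79, 91, 92}" (is "_ = ?S")
proof -
  define ts ss where "ts = triangular ` {..<14}" and "ss = (\<lambda>k::nat. k * k) ` {..<66}"
  define Q where "Q n \<longleftrightarrow> n \<in> ts \<or> n = 2 \<or> n - 1 \<in> ts \<or>
    triangular n - 1 \<in> ss \<or> triangular n \<in> ss" for n
  have iff: "baron_seq n = 1 \<longleftrightarrow> Q n" if n: "2 \<le> n" "n \<le> 92" for n
  proof -
    have T: "1 \<le> triangular n" "triangular n < 66^2"
      using n triangular_mono[of n 92] triangular_mono[of 2 n] by (simp_all add: triangular_def)
    have tri: "(\<exists>i. m = triangular i) \<longleftrightarrow> m \<in> ts" if "m \<le> 92" for m
      using that triangular_less_imp_less[of _ 14] by (auto simp: ts_def triangular_def[of 14])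
    have sqr: "(\<exists>k. m = k^2) \<longleftrightarrow> m \<in> ss" if "m < 66^2" for m
      using that power_less_imp_less_base[of _ 2 "66::nat"] 
      by (auto simp: ss_def power2_eq_square)
    have "(\<exists>i. n = triangular i + 1) \<longleftrightarrow> (\<exists>i. n - 1 = triangular i)"
      "(\<exists>k. triangular n = k^2 + 1) \<longleftrightarrow> (\<exists>k. triangular n - 1 = k^2)"
      using n T by (metis add_diff_cancel_right' le_add_diff_inverse2 one_le_numeral order_trans)+
    then show ?thesis
      using baron_seq_eq_1_iff_cases[OF n(1)] tri[of n] tri[of "n - 1"]
        sqr[of "triangular n"] sqr[of "triangular n - 1"] n T by (auto simp: Q_def)
  qed
  have ts: "ts = {91, 78, 66, 55, 45, 36, 28, 21, 15, 10, 6, 3, 1, 0}"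
    by (simp add: ts_def lessThan_nat_numeral lessThan_Suc triangular_def)
  have ss: "ss = {4225, 4096, 3969, 3844, 3721, 3600, 3481, 3364, 3249, 3136, 3025, 2916, 2809, 2704, 2601, 2500,
      2401, 2304, 2209, 2116, 2025, 1936, 1849, 1764, 1681, 1600, 1521, 1444, 1369, 1296, 1225, 1156,
      1089, 1024, 961, 900, 841, 784, 729, 676, 625, 576, 529, 484, 441, 400, 361, 324,
      289, 256, 225, 196, 169, 144, 121, 100, 81, 64, 49, 36, 25, 16, 9, 4,
      1, 0}"
    by (simp add: ss_def lessThan_nat_numeral lessThan_Suc)
  have "{n \<in> {1..92}. baron_seq n = 1} = set (filter Q [2..<93])"
  proof -
    have "n \<in> {1..92} \<and> baron_seq n = 1 \<longleftrightarrow> n \<in> {2..<93} \<and> Q n" for n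
      using iff[of n] baron_seq_1 by (cases "n = 1") auto
    then show ?thesis by (simp add: set_eq_iff del: upt_rec_numeral)
  qed
  also have "filter Q [2..<93] = [2, 3, 4, 6, 7, 8, 10, 11, 15, 16, 21, 22, 25, 28, 29, 36, 37, 45, 46, 49,
      55, 56, 66, 67, 78, 79, 91, 92]"
    unfolding Q_def ts ss by (simp add: upt_rec_numeral triangular_def)
  finally show ?thesis by simp
qed

section \<open>The numbers of coins that need one weighing\<close>

theorem mainTheorem3:
  shows
    "(\<forall>n\<ge>2. baron_seq n = 1 \<longleftrightarrow>
        (\<exists>i. n = triangular i) \<or>
        n = 2 \<or>
        (\<exists>i. n = triangular i + 1) \<or>
        (\<exists>k. triangular n = k^2 + 1) \<or>
        (\<exists>k. triangular n = k^2))
     \<and> baron_seq 1 = 0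
     \<and> (\<forall>n\<ge>1. baron_seq n = 1 \<longleftrightarrow> (\<exists>w k. proves_weight n [w] k))
     \<and> (\<forall>n\<ge>2. \<forall>i. n = triangular i \<longrightarrow>
          outcome id ({1..i}, {n}) = 0 \<and> proves_weight n [({1..i}, {n})] n)
     \<and> (outcome id ({1}, {2}) = -1 \<and>
          proves_weight 2 [({1}, {2})] 1 \<and> proves_weight 2 [({1}, {2})] 2)
     \<and> (\<forall>n\<ge>2. \<forall>i. n = triangular i + 1 \<longrightarrow>
          outcome id ({1..i}, {n}) = -1 \<and> proves_weight n [({1..i}, {n})] n)
     \<and> (\<forall>n\<ge>2. \<forall>k. triangular n = k^2 + 1 \<longrightarrow>
          outcome id ({1..k - 1}, {k + 1..n}) = -1 \<and>
          proves_weight n [({1..k - 1}, {k + 1..n})] k)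
     \<and> (\<forall>n\<ge>2. \<forall>k. triangular n = k^2 \<longrightarrow>
          outcome id ({1..k - 1}, {k + 1..n}) = 0 \<and>
          proves_weight n [({1..k - 1}, {k + 1..n})] k)
     \<and> {n \<in> {1..92}. baron_seq n = 1} =
          {2, 3, 4, 6, 7, 8, 10, 11, 15, 16, 21, 22, 25, 28, 29, 36, 37, 45, 46, 49,
           55, 56, 66, 67, 78, 79, 91, 92}"
proof (intro conjI)
  show "\<forall>n\<ge>2. baron_seq n = 1 \<longleftrightarrow>
        (\<exists>i. n = triangular i) \<or>
        n = 2 \<or>
        (\<exists>i. n = triangular i + 1) \<or>
        (\<exists>k. triangular n = k^2 + 1) \<or>
        (\<exists>k. triangular n = k^2)"
    using baron_seq_eq_1_iff_cases by blast
  show "baron_seq 1 = 0" by (rule baron_seq_1)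
  show "\<forall>n\<ge>1. baron_seq n = 1 \<longleftrightarrow> (\<exists>w k. proves_weight n [w] k)"
    using baron_seq_eq_1_iff by blast
  show "\<forall>n\<ge>2. \<forall>i. n = triangular i \<longrightarrow>
          outcome id ({1..i}, {n}) = 0 \<and> proves_weight n [({1..i}, {n})] n"
    using heavy_coin_sufficient by (auto simp: outcome_id sum_atLeast1[simplified])
  show "outcome id ({1}, {2}) = -1" by (simp add: outcome_id)
  show "proves_weight 2 [({1}, {2})] 1" "proves_weight 2 [({1}, {2})] 2"
    by (rule two_coins)+
  show "\<forall>n\<ge>2. \<forall>i. n = triangular i + 1 \<longrightarrow>
          outcome id ({1..i}, {n}) = -1 \<and> proves_weight n [({1..i}, {n})] n"
    using heavy_coin_sufficient by (auto simp: outcome_id sum_atLeast1[simplified])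
  show "\<forall>n\<ge>2. \<forall>k. triangular n = k^2 + 1 \<longrightarrow>
          outcome id ({1..k - 1}, {k + 1..n}) = -1 \<and>
          proves_weight n [({1..k - 1}, {k + 1..n})] k"
  proof (intro allI impI)
    fix n k :: nat
    assume n: "2 \<le> n" "triangular n = k^2 + 1"
    then have "triangular n = k^2 \<or> triangular n = k^2 + 1" by blast
    from middle_coin(3,4)[OF n(1) this] n(2)
    show "outcome id ({1..k - 1}, {k + 1..n}) = -1 \<and>
      proves_weight n [({1..k - 1}, {k + 1..n})] k"
      by (simp only: outcome_id) simp
  qed
  show "\<forall>n\<ge>2. \<forall>k. triangular n = k^2 \<longrightarrow>
          outcome id ({1..k - 1}, {k + 1..n}) = 0 \<and>
          proves_weight n [({1..k - 1}, {k + 1..n})] k"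
  proof (intro allI impI)
    fix n k :: nat
    assume n: "2 \<le> n" "triangular n = k^2"
    then have "triangular n = k^2 \<or> triangular n = k^2 + 1" by blast
    from middle_coin(3,4)[OF n(1) this] n(2)
    show "outcome id ({1..k - 1}, {k + 1..n}) = 0 \<and>
      proves_weight n [({1..k - 1}, {k + 1..n})] k"
      by (simp only: outcome_id) simp
  qed
qed (rule baron_seq_table)

end
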